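(* Let $R=Q/P$ be a rational function with $P,Q\in\mathbb{C}[z]$ coprime and with $R'$ nonconstant. Let $W=Q'P-QP'$, $k=\deg Q$, $\ell=\deg P$, $n=\deg W$, and $$F_R(z,\bar z)=\frac{W(z)\,\overline{P(z)}^{\,2}-\overline{W(z)}\,P(z)^2}{2i},$$ regarded as a real polynomial in $x,y$ where $z=x+iy$. Then the affine inflection curve $\mathfrak{I}_R$ is contained in a real algebraic curve of degree at most $n+2\ell$. For generic pairs $(P,Q)$ with $k\neq\ell$, one has $n=k+\ell-1$ and the degree of $F_R$ is $k+3\ell-1$. If $k=\ell$, the leading terms cancel in $W$, and for generic pairs $(P,Q)$ one has $n=2\ell-2$ and the degree of $F_R$ is $4\ell-2$.
   Context: The affine inflection curve $\mathfrak{I}_R$ is the closure in $\mathbb{C}$ of $\{z\in\mathbb{C}: R(z)\neq0,\ P(z)\neq0,\ \operatorname{Im}R'(z)=0\}$; it equals the zero set of $F_R$. "Generic pairs $(P,Q)$" means: for fixed degrees $k,\ell$, all coefficient vectors outside a proper real algebraic subset of the (real) parameter space of pairs of polynomials of degrees $\ell$ and $k$. *)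

theory Defs
  imports "HOL-Analysis.Analysis" "HOL-Computational_Algebra.Polynomial"
begin

section \<open>Real polynomials in two variables\<close>

text \<open>
  An element of \<^typ>\<open>'a poly poly\<close> is read as a polynomial in \<open>x\<close> and \<open>y\<close>: the outer variable
  is \<open>y\<close> and the coefficients are polynomials in \<open>x\<close>, so that \<open>coeff (coeff G j) i\<close> is the
  coefficient of \<open>x\<^sup>i y\<^sup>j\<close>.
\<close>

definition poly2 :: "'a::comm_ring_1 poly poly \<Rightarrow> 'a \<Rightarrow> 'a \<Rightarrow> 'a" where
  "poly2 G x y = poly (poly G [:y:]) x"

text \<open>The zero polynomial gets total degree 0, as with \<^const>\<open>degree\<close>.\<close>

definition total_degree :: "'a::zero poly poly \<Rightarrow> nat" where
  "total_degree G = Max (insert 0 {i + j | i j. coeff (coeff G j) i \<noteq> 0})"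

text \<open>The plane is identified with the complex numbers by \<open>z = x + \<i>y\<close>.\<close>

definition zero_locus :: "real poly poly \<Rightarrow> complex set" where
  "zero_locus G = {z. poly2 G (Re z) (Im z) = 0}"

definition real_algebraic_curve :: "complex set \<Rightarrow> nat \<Rightarrow> bool" where
  "real_algebraic_curve C d \<longleftrightarrow> (\<exists>G. total_degree G = d \<and> d > 0 \<and> C = zero_locus G)"


section \<open>The inflection curve of a rational function\<close>

text \<open>
  As functions, the values of \<open>Q/P\<close> at zeros of \<open>P\<close> are junk; they are never used below.
\<close>

definition ratfun :: "complex poly \<Rightarrow> complex poly \<Rightarrow> complex \<Rightarrow> complex" where
  "ratfun P Q z = poly Q z / poly P z"

definition nonconstant_deriv :: "complex poly \<Rightarrow> complex poly \<Rightarrow> bool" where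
  "nonconstant_deriv P Q \<longleftrightarrow> \<not> deriv (ratfun P Q) constant_on {z. poly P z \<noteq> 0}"

definition inflection_curve :: "complex poly \<Rightarrow> complex poly \<Rightarrow> complex set" where
  "inflection_curve P Q =
     closure {z. ratfun P Q z \<noteq> 0 \<and> poly P z \<noteq> 0 \<and> Im (deriv (ratfun P Q) z) = 0}"

definition W_poly :: "complex poly \<Rightarrow> complex poly \<Rightarrow> complex poly" where
  "W_poly P Q = pderiv Q * P - Q * pderiv P"

definition F_fun :: "complex poly \<Rightarrow> complex poly \<Rightarrow> complex \<Rightarrow> complex" where
  "F_fun P Q z = (poly (W_poly P Q) z * cnj (poly P z) ^ 2
                    - cnj (poly (W_poly P Q) z) * poly P z ^ 2) / (2 * \<i>)"

text \<open>
  To regard \<^const>\<open>F_fun\<close> as a polynomial in \<open>x\<close> and \<open>y\<close>, substitute \<open>x + \<i>y\<close> for \<open>z\<close> and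
  \<open>x - \<i>y\<close> for its conjugate. The result has real coefficients, so taking real parts of
  coefficients only changes the type.
\<close>

definition subst2 :: "complex poly \<Rightarrow> complex poly poly \<Rightarrow> complex poly poly" where
  "subst2 p Z = poly (map_poly (\<lambda>c. [:[:c:]:]) p) Z"

definition F_poly :: "complex poly \<Rightarrow> complex poly \<Rightarrow> real poly poly" where
  "F_poly P Q =
    (let z = [:[:0, 1:], [:\<i>:]:]; zbar = [:[:0, 1:], [:- \<i>:]:]; W = W_poly P Q
     in map_poly (map_poly Re)
          (smult [:1 / (2 * \<i>):]
            (subst2 W z * subst2 (map_poly cnj P) zbar ^ 2
               - subst2 (map_poly cnj W) zbar * subst2 P z ^ 2)))"

lemma poly2_smult: "poly2 (smult c G) x y = poly c x * poly2 G x y"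
  and poly2_diff: "poly2 (G - H) x y = poly2 G x y - poly2 H x y"
  and poly2_mult: "poly2 (G * H) x y = poly2 G x y * poly2 H x y"
  and poly2_power: "poly2 (G ^ m) x y = poly2 G x y ^ m"
  by (simp_all add: poly2_def)

lemma poly2_subst2: "poly2 (subst2 p Z) x y = poly p (poly2 Z x y)"
  by (induction p) (simp_all add: poly2_def subst2_def map_poly_pCons)

lemma poly2_map_Re:
  "poly2 (map_poly (map_poly Re) G) x y = Re (poly2 G (of_real x) (of_real y))"
proof -
  have 1: "poly (map_poly Re p) x = Re (poly p (of_real x))" for p x
    by (induction p) (simp_all add: map_poly_pCons)
  show ?thesis
    by (induction G) (simp_all add: poly2_def map_poly_pCons 1)
qed

lemma poly2_F_poly: "of_real (poly2 (F_poly P Q) x y) = F_fun P Q (Complex x y)"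
proof -
  have cnj_poly: "poly (map_poly cnj p) (cnj z) = cnj (poly p z)" for p z
    by (induction p) (simp_all add: map_poly_pCons)
  define z where "z = Complex x y"
  have z: "poly2 [:[:0, 1:], [:\<i>:]:] (of_real x) (of_real y) = z"
    and zbar: "poly2 [:[:0, 1:], [:- \<i>:]:] (of_real x) (of_real y) = cnj z"
    by (simp_all add: poly2_def z_def complex_eq_iff)
  have "poly2 (F_poly P Q) x y = Re (F_fun P Q z)"
    unfolding F_poly_def Let_def poly2_map_Re
    by (simp add: poly2_smult poly2_diff poly2_mult poly2_power poly2_subst2 z zbar cnj_poly
        F_fun_def)
  moreover have "cnj (F_fun P Q z) = F_fun P Q z"
    by (simp add: F_fun_def field_simps)
  ultimately show ?thesis
    by (metis z_def Reals_cnj_iff of_real_Re)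
qed


section \<open>Generic pairs of polynomials\<close>

text \<open>Real polynomial functions in the given coordinate functions \<open>X\<close>.\<close>

inductive polynomial_in :: "('a \<Rightarrow> real) set \<Rightarrow> ('a \<Rightarrow> real) \<Rightarrow> bool" for X where
  const: "polynomial_in X (\<lambda>_. c)"
| coord: "f \<in> X \<Longrightarrow> polynomial_in X f"
| add: "polynomial_in X f \<Longrightarrow> polynomial_in X g \<Longrightarrow> polynomial_in X (\<lambda>v. f v + g v)"
| mult: "polynomial_in X f \<Longrightarrow> polynomial_in X g \<Longrightarrow> polynomial_in X (\<lambda>v. f v * g v)"

text \<open>
  A pair \<open>(P, Q)\<close> with \<open>degree P \<le> l\<close> and \<open>degree Q \<le> k\<close> is identified with its coefficient vector.
  The parameter space is thus a real vector space of dimension \<open>2 (l + 1) + 2 (k + 1)\<close>, with the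
  real and imaginary parts of the coefficients as coordinates.
\<close>

definition pair_space :: "nat \<Rightarrow> nat \<Rightarrow> (complex poly \<times> complex poly) set" where
  "pair_space l k = {(P, Q). degree P \<le> l \<and> degree Q \<le> k}"

definition pair_coords :: "nat \<Rightarrow> nat \<Rightarrow> (complex poly \<times> complex poly \<Rightarrow> real) set" where
  "pair_coords l k =
     (\<Union>i\<le>l. {\<lambda>(P, Q). Re (coeff P i), \<lambda>(P, Q). Im (coeff P i)}) \<union>
     (\<Union>i\<le>k. {\<lambda>(P, Q). Re (coeff Q i), \<lambda>(P, Q). Im (coeff Q i)})"

definition real_algebraic_subset :: "nat \<Rightarrow> nat \<Rightarrow> (complex poly \<times> complex poly) set \<Rightarrow> bool" where
  "real_algebraic_subset l k Z \<longleftrightarrow>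
     (\<exists>S. (\<forall>f\<in>S. polynomial_in (pair_coords l k) f) \<and> Z = {v \<in> pair_space l k. \<forall>f\<in>S. f v = 0})"

definition generic_pairs ::
    "nat \<Rightarrow> nat \<Rightarrow> (complex poly \<Rightarrow> complex poly \<Rightarrow> bool) \<Rightarrow> bool" where
  "generic_pairs l k \<Phi> \<longleftrightarrow>
     (\<exists>Z. real_algebraic_subset l k Z \<and> Z \<noteq> pair_space l k \<and>
        (\<forall>P Q. degree P = l \<and> degree Q = k \<and> (P, Q) \<notin> Z \<longrightarrow> \<Phi> P Q))"

end

theory Submission
  imports Defs "HOL-Complex_Analysis.Conformal_Mappings"
    "HOL-Computational_Algebra.Fundamental_Theorem_Algebra"
begin

text \<open>
  The curve lies in the zero locus of \<open>F\<close>, and the degree bound is immediate from the shape of \<open>F\<close>. If \<open>F\<close>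
  were constant, then \<open>Im R'\<close> would be constant too (when \<open>P\<close> has a zero, \<open>F\<close> vanishes there), against
  the open mapping theorem. Generically the degree bound is attained already on the real axis: there
  \<open>F\<close> is a polynomial in \<open>x\<close> whose coefficient of degree \<open>n + 2\<ell>\<close> is the imaginary part of
  \<open>w \<cdot> cnj p ^ 2\<close> with \<open>w\<close>, \<open>p\<close> the leading coefficients of \<open>W\<close>, \<open>P\<close>. So the exceptional set is the
  vanishing set of this imaginary part, a polynomial in the real coordinates.
\<close>

section \<open>Total degree in two variables and the upper bound for \<open>F_poly\<close>\<close>

lemma finite_total_degree_set: "finite {i + j | i j. coeff (coeff G j) i \<noteq> 0}"
proof (rule finite_subset)
  show "{i + j | i j. coeff (coeff G j) i \<noteq> 0}
      \<subseteq> (\<Union>j\<le>degree G. (\<lambda>i. i + j) ` {..degree (coeff G j)})"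
  proof
    fix d assume "d \<in> {i + j | i j. coeff (coeff G j) i \<noteq> 0}"
    then obtain i j where d: "d = i + j" and nz: "coeff (coeff G j) i \<noteq> 0" by blast
    have "j \<le> degree G" using nz by (intro le_degree) auto
    moreover have "i \<le> degree (coeff G j)" using nz by (rule le_degree)
    ultimately show "d \<in> (\<Union>j\<le>degree G. (\<lambda>i. i + j) ` {..degree (coeff G j)})"
      using d by auto
  qed
qed simp

lemma total_degree_le_iff:
  "total_degree G \<le> d \<longleftrightarrow> (\<forall>i j. coeff (coeff G j) i \<noteq> 0 \<longrightarrow> i + j \<le> d)"
  unfolding total_degree_def using finite_total_degree_set[of G]
  by (subst Max_le_iff) auto

lemma le_total_degree: "coeff (coeff G j) i \<noteq> 0 \<Longrightarrow> i + j \<le> total_degree G"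
  using total_degree_le_iff[of G "total_degree G"] by blast

text \<open>A nonzero coefficient of the product needs a nonzero term in its convolution sum; the
  exponents of the two factors of that term add up to \<open>i + j\<close>.\<close>

lemma total_degree_mult_le:
  fixes G H :: "'a::comm_ring_1 poly poly"
  assumes "total_degree G \<le> d" "total_degree H \<le> e"
  shows "total_degree (G * H) \<le> d + e"
  unfolding total_degree_le_iff
proof (intro allI impI)
  fix i j assume "coeff (coeff (G * H) j) i \<noteq> 0"
  then have "(\<Sum>b\<le>j. \<Sum>a\<le>i. coeff (coeff G b) a * coeff (coeff H (j - b)) (i - a)) \<noteq> 0"
    by (simp add: coeff_mult coeff_sum)
  then obtain b where b: "b \<le> j"
    and "(\<Sum>a\<le>i. coeff (coeff G b) a * coeff (coeff H (j - b)) (i - a)) \<noteq> 0"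
    by (meson sum.not_neutral_contains_not_neutral atMost_iff)
  then obtain a where a: "a \<le> i"
    and nz: "coeff (coeff G b) a * coeff (coeff H (j - b)) (i - a) \<noteq> 0"
    by (meson sum.not_neutral_contains_not_neutral atMost_iff)
  have "coeff (coeff G b) a \<noteq> 0" "coeff (coeff H (j - b)) (i - a) \<noteq> 0"
    using nz by auto
  then have "a + b \<le> d" "(i - a) + (j - b) \<le> e"
    using assms unfolding total_degree_le_iff by blast+
  with a b show "i + j \<le> d + e" by linarith
qed

lemma total_degree_add_le:
  "total_degree G \<le> d \<Longrightarrow> total_degree H \<le> d \<Longrightarrow> total_degree (G + H) \<le> d"
  unfolding total_degree_le_iff by (metis add.right_neutral coeff_add)

lemma total_degree_diff_le:
  fixes G H :: "'a::comm_ring_1 poly poly"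
  shows "total_degree G \<le> d \<Longrightarrow> total_degree H \<le> d \<Longrightarrow> total_degree (G - H) \<le> d"
  unfolding total_degree_le_iff by (metis diff_zero coeff_diff)

lemma total_degree_const [simp]: "total_degree [:[:c:]:] = 0"
proof -
  have "total_degree [:[:c:]:] \<le> 0"
    unfolding total_degree_le_iff by (auto simp: coeff_pCons split: nat.splits)
  then show ?thesis by simp
qed

lemma total_degree_smult_const_le:
  fixes G :: "'a::comm_ring_1 poly poly"
  shows "total_degree G \<le> d \<Longrightarrow> total_degree (smult [:c:] G) \<le> d"
  unfolding total_degree_le_iff by simp (metis mult_zero_right)

lemma total_degree_power_le:
  fixes G :: "'a::comm_ring_1 poly poly"
  assumes "total_degree G \<le> d"
  shows "total_degree (G ^ m) \<le> m * d"
proof (induction m)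
  case 0
  have "(1 :: 'a poly poly) = [:[:1:]:]" by (simp add: one_pCons)
  then show ?case by (metis mult_zero_left order_refl power_0 total_degree_const)
next
  case (Suc m)
  then show ?case using total_degree_mult_le[OF assms Suc] by simp
qed

lemma total_degree_linear_le: "total_degree [:[:a, b:], [:c:]:] \<le> 1"
  unfolding total_degree_le_iff by (auto simp: coeff_pCons split: nat.splits)

lemma total_degree_subst2_le:
  assumes "total_degree Z \<le> 1"
  shows "total_degree (subst2 p Z) \<le> degree p"
proof (induction p)
  case 0
  show ?case
    using total_degree_const[of 0] by (simp add: subst2_def)
next
  case (pCons a p)
  have step: "subst2 (pCons a p) Z = [:[:a:]:] + Z * subst2 p Z"
    by (simp add: subst2_def map_poly_pCons)
  show ?case
  \<comment> \<open>For \<open>p = 0\<close> the degree of \<open>pCons a p\<close> is 0 and not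
    \<open>1 + degree p\<close>, so the product has to vanish.\<close>
  proof (cases "p = 0")
    case True
    then have "subst2 p Z = 0" by (simp add: subst2_def)
    then show ?thesis unfolding step by simp
  next
    case False
    have "total_degree (Z * subst2 p Z) \<le> 1 + degree p"
      by (rule total_degree_mult_le[OF assms pCons.IH])
    then show ?thesis
      using False unfolding step by (intro total_degree_add_le) simp_all
  qed
qed

lemma total_degree_map_Re_le:
  "total_degree G \<le> d \<Longrightarrow> total_degree (map_poly (map_poly Re) G) \<le> d"
  unfolding total_degree_le_iff by (simp add: coeff_map_poly) (metis zero_complex.sel(1))

lemma degree_map_poly_cnj [simp]: "degree (map_poly cnj p) = degree p"
  by (rule degree_map_poly) simp

lemma total_degree_F_poly_le: "total_degree (F_poly P Q) \<le> degree (W_poly P Q) + 2 * degree P"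
proof -
  have subst_le: "total_degree (subst2 p [:[:0, 1:], [:c:]:]) \<le> degree p" for p c
    by (intro total_degree_subst2_le total_degree_linear_le)
  have cnj_le: "total_degree (subst2 (map_poly cnj p) [:[:0, 1:], [:c:]:]) \<le> degree p" for p c
    using subst_le[of "map_poly cnj p" c] by simp
  show ?thesis
    unfolding F_poly_def Let_def
    by (intro total_degree_map_Re_le total_degree_smult_const_le total_degree_diff_le
        total_degree_mult_le total_degree_power_le subst_le cnj_le)
qed

section \<open>Restriction of \<open>F\<close> to the real axis\<close>

text \<open>Taking the coefficient of \<open>y^0\<close> sets \<open>y = 0\<close>, a ring
  homomorphism, so it commutes with substitution.\<close>

lemma coeff_subst2_0: "coeff (subst2 p Z) 0 = pcompose p (coeff Z 0)"
  by (induction p) (simp_all add: subst2_def map_poly_pCons pcompose_pCons mult.commute coeff_mult_0)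

text \<open>For \<open>y = 0\<close> both \<open>z\<close> and its conjugate become
  \<open>x\<close>, so \<open>F\<close> is \<open>(A - cnj A) / (2 * \<i>)\<close> with
  \<open>A\<close> the product on the right, conjugated coefficientwise.\<close>

lemma coeff_F_poly_real_axis:
  "coeff (coeff (F_poly P Q) 0) m =
     Im (coeff (W_poly P Q * (map_poly cnj P)\<^sup>2) m)"
proof -
  define A where "A = W_poly P Q * (map_poly cnj P)\<^sup>2"
  have cnj_mult: "map_poly cnj (p * q) = map_poly cnj p * map_poly cnj q" for p q
    by (rule poly_eqI) (simp add: coeff_map_poly coeff_mult)
  have cnj_cnj: "map_poly cnj (map_poly cnj p) = p" for p
    by (rule poly_eqI) (simp add: coeff_map_poly)
  have X: "pcompose p [:0, 1:] = p" for p :: "complex poly"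
    by (rule pcompose_idR)
  have "map_poly cnj A = map_poly cnj (W_poly P Q) * P\<^sup>2"
    by (simp add: A_def cnj_mult cnj_cnj power2_eq_square)
  then have "coeff (coeff (F_poly P Q) 0) m = Re (coeff (A - map_poly cnj A) m / (2 * \<i>))"
    by (simp add: F_poly_def Let_def coeff_map_poly coeff_mult_0 coeff_0_power coeff_subst2_0 X
        flip: A_def)
  also have "\<dots> = Im (coeff A m)"
    by (simp add: coeff_map_poly complex_diff_cnj)
  finally show ?thesis by (simp add: A_def)
qed

text \<open>By assumption the restriction to the real axis has a nonzero coefficient exactly at the
  upper bound. That \<open>F_poly P Q\<close> is nonzero is recorded separately, since the zero
  polynomial has total degree 0 as well.\<close>

lemma total_degree_F_poly_eq:
  assumes "Im (lead_coeff (W_poly P Q) * (cnj (lead_coeff P))\<^sup>2) \<noteq> 0"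
  shows "F_poly P Q \<noteq> 0" "total_degree (F_poly P Q) = degree (W_poly P Q) + 2 * degree P"
proof -
  let ?A = "W_poly P Q * (map_poly cnj P)\<^sup>2"
  have "W_poly P Q \<noteq> 0" "P \<noteq> 0" using assms by auto
  then have "degree ?A = degree (W_poly P Q) + 2 * degree P"
    by (subst degree_mult_eq)
      (auto simp: degree_power_eq map_poly_eq_0_iff)
  moreover have "lead_coeff ?A = lead_coeff (W_poly P Q) * (cnj (lead_coeff P))\<^sup>2"
    by (simp add: lead_coeff_mult lead_coeff_power coeff_map_poly del: coeff_degree_mult)
  ultimately have nz: "coeff (coeff (F_poly P Q) 0) (degree (W_poly P Q) + 2 * degree P) \<noteq> 0"
    using assms by (simp add: coeff_F_poly_real_axis)
  then show "F_poly P Q \<noteq> 0" by auto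
  show "total_degree (F_poly P Q) = degree (W_poly P Q) + 2 * degree P"
    using le_total_degree[OF nz] total_degree_F_poly_le[of P Q] by linarith
qed

section \<open>Degree and leading coefficient of \<open>W\<close>\<close>

text \<open>Every other term of the convolution has an index beyond \<open>m\<close> or beyond
  \<open>n\<close>. Bounds in place of exact degrees keep the formula available when a coefficient
  at the bound is 0.\<close>

lemma coeff_mult_at_bound:
  fixes p q :: "'a::comm_semiring_0 poly"
  assumes "degree p \<le> m" "degree q \<le> n"
  shows "coeff (p * q) (m + n) = coeff p m * coeff q n"
proof -
  have "coeff p i * coeff q (m + n - i) = 0" if "i \<noteq> m" for i
  proof (cases "i < m")
    case True
    then show ?thesis using assms(2) by (simp add: coeff_eq_0)
  next
    case False
    then show ?thesis using that assms(1) by (simp add: coeff_eq_0)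
  qed
  then have "(\<Sum>i\<le>m + n. coeff p i * coeff q (m + n - i))
      = (\<Sum>i\<in>{m}. coeff p i * coeff q (m + n - i))"
    by (intro sum.mono_neutral_right) auto
  then show ?thesis by (simp add: coeff_mult)
qed

lemma pderiv_mult_at_bound:
  fixes p q :: "complex poly"
  assumes "degree p \<le> m" "degree q \<le> n" "m + n \<ge> 1"
  shows "degree (pderiv p * q) \<le> m + n - 1"
    and "coeff (pderiv p * q) (m + n - 1) = of_nat m * coeff p m * coeff q n"
proof -
  have "degree (pderiv p * q) \<le> m + n - 1 \<and>
      coeff (pderiv p * q) (m + n - 1) = of_nat m * coeff p m * coeff q n"
  \<comment> \<open>Differentiation lowers the bound \<open>m\<close> only if it is positive; for
    \<open>m = 0\<close> the derivative and the factor \<open>of_nat m\<close> are both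
    zero.\<close>
  proof (cases m)
    case 0
    then have "pderiv p = 0" using assms(1) by (simp add: pderiv_eq_0_iff)
    with 0 show ?thesis by simp
  next
    case (Suc r)
    have r: "degree (pderiv p) \<le> r" using assms(1) Suc by (simp add: degree_pderiv)
    show ?thesis
      using degree_mult_le[of "pderiv p" q] r assms(2) coeff_mult_at_bound[OF r assms(2)] Suc
      by (simp add: coeff_pderiv)
  qed
  then show "degree (pderiv p * q) \<le> m + n - 1"
    and "coeff (pderiv p * q) (m + n - 1) = of_nat m * coeff p m * coeff q n" by auto
qed

text \<open>With \<open>p\<close>, \<open>q\<close> the coefficients of \<open>P\<close>,
  \<open>Q\<close> at their bounds, the two products in \<open>W\<close> contribute
  \<open>k * p * q\<close> and \<open>l * p * q\<close>. The difference vanishes for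
  \<open>k = l\<close>, which is why equal degrees are treated separately.\<close>

lemma W_poly_at_bound:
  assumes "degree P \<le> l" "degree Q \<le> k" "k + l \<ge> 1"
  shows "degree (W_poly P Q) \<le> k + l - 1"
    and "coeff (W_poly P Q) (k + l - 1) = (of_nat k - of_nat l) * coeff P l * coeff Q k"
proof -
  have eq: "W_poly P Q = pderiv Q * P - pderiv P * Q"
    by (simp add: W_poly_def mult.commute)
  have lk: "l + k \<ge> 1" using assms(3) by simp
  note Q = pderiv_mult_at_bound[OF assms(2,1,3)]
  note P = pderiv_mult_at_bound[OF assms(1,2) lk, unfolded add.commute[of l k]]
  show "degree (W_poly P Q) \<le> k + l - 1"
    unfolding eq by (rule degree_diff_le[OF Q(1) P(1)])
  show "coeff (W_poly P Q) (k + l - 1) = (of_nat k - of_nat l) * coeff P l * coeff Q k"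
    unfolding eq coeff_diff Q(2) P(2) by (simp add: algebra_simps)
qed

text \<open>\<open>W\<close> is the numerator of the derivative of \<open>Q / P\<close>, which is
  the same for \<open>Q / P - c\<close>.\<close>

lemma W_poly_smult_diff: "W_poly P (Q - smult c P) = W_poly P Q"
  by (simp add: W_poly_def pderiv_diff pderiv_smult algebra_simps)

text \<open>
  Subtracting from \<open>Q\<close> the multiple of \<open>P\<close> that kills its leading term does not change \<open>W\<close> and
  reduces to the case of different degrees.
\<close>

lemma W_poly_equal_degrees:
  assumes "degree P = l" "degree Q \<le> l" "l \<ge> 1"
  shows "degree (W_poly P Q) \<le> 2 * l - 2"
    and "coeff (W_poly P Q) (2 * l - 2) = coeff Q l * coeff P (l - 1) - coeff P l * coeff Q (l - 1)"
proof -
  define c where "c = coeff Q l / coeff P l"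
  define S where "S = Q - smult c P"
  have P: "coeff P l \<noteq> 0" using assms by auto
  have "coeff S i = 0" if "i > l - 1" for i
  proof (cases "i = l")
    case True
    then show ?thesis using P by (simp add: S_def c_def)
  next
    case False
    then show ?thesis using that assms by (simp add: S_def coeff_eq_0)
  qed
  then have S: "degree S \<le> l - 1" by (meson degree_le)
  have *: "(l - 1) + l \<ge> 1" "(l - 1) + l - 1 = 2 * l - 2" using assms(3) by simp_all
  note W = W_poly_at_bound[OF eq_refl[OF assms(1)] S *(1), unfolded *(2)]
  show "degree (W_poly P Q) \<le> 2 * l - 2"
    using W(1) by (simp add: S_def W_poly_smult_diff)
  \<comment> \<open>With \<open>l - 1\<close> in place of \<open>k\<close>, the factor
    \<open>k - l\<close> becomes -1.\<close>
  have "coeff (W_poly P Q) (2 * l - 2) = - (coeff P l * coeff S (l - 1))"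
    using W(2) assms(3) by (simp add: S_def W_poly_smult_diff of_nat_diff)
  also have "\<dots> = coeff Q l * coeff P (l - 1) - coeff P l * coeff Q (l - 1)"
    using P by (simp add: S_def c_def field_simps)
  finally show "coeff (W_poly P Q) (2 * l - 2) =
      coeff Q l * coeff P (l - 1) - coeff P l * coeff Q (l - 1)" .
qed

section \<open>Genericity through real polynomial conditions on coefficients\<close>

text \<open>Splitting into real and imaginary parts admits conjugates of coefficients, as the real
  parameter space requires.\<close>

definition complex_polynomial_in :: "('a \<Rightarrow> real) set \<Rightarrow> ('a \<Rightarrow> complex) \<Rightarrow> bool" where
  "complex_polynomial_in X f \<longleftrightarrow>
     polynomial_in X (\<lambda>v. Re (f v)) \<and> polynomial_in X (\<lambda>v. Im (f v))"

lemma polynomial_in_diff: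
  assumes "polynomial_in X f" "polynomial_in X g"
  shows "polynomial_in X (\<lambda>v. f v - g v)"
  using polynomial_in.add[OF assms(1) polynomial_in.mult[OF polynomial_in.const[of X "- 1"] assms(2)]]
  by simp

lemma complex_polynomial_in_diff:
  "complex_polynomial_in X f \<Longrightarrow> complex_polynomial_in X g \<Longrightarrow>
    complex_polynomial_in X (\<lambda>v. f v - g v)"
  by (simp add: complex_polynomial_in_def polynomial_in_diff)

lemma complex_polynomial_in_mult:
  "complex_polynomial_in X f \<Longrightarrow> complex_polynomial_in X g \<Longrightarrow>
    complex_polynomial_in X (\<lambda>v. f v * g v)"
  by (simp add: complex_polynomial_in_def polynomial_in_diff polynomial_in.intros)

lemma complex_polynomial_in_cnj:
  assumes "complex_polynomial_in X f"
  shows "complex_polynomial_in X (\<lambda>v. cnj (f v))"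
  using assms polynomial_in_diff[OF polynomial_in.const[of X 0], of "\<lambda>v. Im (f v)"]
  by (simp add: complex_polynomial_in_def)

lemma complex_polynomial_in_coeff:
  "i \<le> l \<Longrightarrow> complex_polynomial_in (pair_coords l k) (\<lambda>v. coeff (fst v) i)"
  "i \<le> k \<Longrightarrow> complex_polynomial_in (pair_coords l k) (\<lambda>v. coeff (snd v) i)"
  unfolding complex_polynomial_in_def pair_coords_def case_prod_unfold
  by (intro conjI polynomial_in.coord; blast)+

text \<open>The exceptional set is the zero set of the single polynomial \<open>Im f\<close>. The
  witness makes it proper; lying in \<open>pair_space l k\<close>, it may have degrees below
  \<open>l\<close> and \<open>k\<close>.\<close>

lemma generic_pairsI:
  assumes f: "complex_polynomial_in (pair_coords l k) f"
    and witness: "(P0, Q0) \<in> pair_space l k" "Im (f (P0, Q0)) \<noteq> 0"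
    and \<Phi>: "\<And>P Q. degree P = l \<Longrightarrow> degree Q = k \<Longrightarrow> Im (f (P, Q)) \<noteq> 0 \<Longrightarrow> \<Phi> P Q"
  shows "generic_pairs l k \<Phi>"
proof -
  define Z where "Z = {v \<in> pair_space l k. \<forall>g\<in>{\<lambda>v. Im (f v)}. g v = 0}"
  have "real_algebraic_subset l k Z"
    using f unfolding Z_def real_algebraic_subset_def complex_polynomial_in_def by blast
  moreover have "(P0, Q0) \<notin> Z" using witness(2) by (simp add: Z_def)
  moreover have "\<Phi> P Q" if "degree P = l \<and> degree Q = k \<and> (P, Q) \<notin> Z" for P Q
    using that by (intro \<Phi>) (auto simp: Z_def pair_space_def)
  ultimately show ?thesis using witness(1) unfolding generic_pairs_def by blast
qed

text \<open>For leading coefficients \<open>p\<close>, \<open>q\<close> of \<open>P\<close>,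
  \<open>Q\<close>, that of \<open>W\<close> is \<open>w = (k - l) * p * q\<close>. Hence
  \<open>w * cnj p ^ 2\<close> is \<open>q * cnj p\<close> times the nonzero real number
  \<open>(k - l) * |p|^2\<close>, and \<open>Im (q * cnj p)\<close> suffices as the test
  polynomial.\<close>

lemma generic_degrees_distinct:
  assumes "k \<noteq> l"
  shows "generic_pairs l k (\<lambda>P Q.
        W_poly P Q \<noteq> 0 \<and> int (degree (W_poly P Q)) = int k + int l - 1 \<and>
        F_poly P Q \<noteq> 0 \<and> int (total_degree (F_poly P Q)) = int k + 3 * int l - 1)"
proof (rule generic_pairsI)
  show "complex_polynomial_in (pair_coords l k) (\<lambda>v. coeff (snd v) k * cnj (coeff (fst v) l))"
    by (intro complex_polynomial_in_mult complex_polynomial_in_cnj complex_polynomial_in_coeff) auto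
  show "(monom 1 l, monom \<i> k) \<in> pair_space l k"
    by (simp add: pair_space_def degree_monom_eq)
  show "Im (coeff (snd (monom 1 l, monom \<i> k)) k * cnj (coeff (fst (monom 1 l, monom \<i> k)) l)) \<noteq> 0"
    by simp
next
  fix P Q :: "complex poly"
  assume P: "degree P = l" and Q: "degree Q = k"
    and "Im (coeff (snd (P, Q)) k * cnj (coeff (fst (P, Q)) l)) \<noteq> 0"
  then have im: "Im (coeff Q k * cnj (coeff P l)) \<noteq> 0" by simp
  then have nz: "coeff Q k \<noteq> 0" "coeff P l \<noteq> 0" by auto
  have kl: "k + l \<ge> 1" using assms by linarith
  note W = W_poly_at_bound[OF eq_refl[OF P] eq_refl[OF Q] kl]
  have "coeff (W_poly P Q) (k + l - 1) \<noteq> 0" using W(2) nz assms by simp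
  then have deg: "degree (W_poly P Q) = k + l - 1" and W0: "W_poly P Q \<noteq> 0"
    using W(1) by (auto intro: le_antisym le_degree)
  have "coeff (W_poly P Q) (k + l - 1) * (cnj (coeff P l))\<^sup>2
      = of_real ((real k - real l) * (cmod (coeff P l))\<^sup>2) * (coeff Q k * cnj (coeff P l))"
    unfolding W(2) of_real_mult complex_norm_square by (simp add: power2_eq_square)
  then have "Im (lead_coeff (W_poly P Q) * (cnj (lead_coeff P))\<^sup>2) \<noteq> 0"
    using im nz assms by (simp add: deg P Im_complex_of_real del: of_real_mult of_real_diff)
  from total_degree_F_poly_eq[OF this] W0 deg kl
  show "W_poly P Q \<noteq> 0 \<and> int (degree (W_poly P Q)) = int k + int l - 1 \<and>
        F_poly P Q \<noteq> 0 \<and> int (total_degree (F_poly P Q)) = int k + 3 * int l - 1"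
    by (simp add: P of_nat_diff)
qed

lemma generic_degrees_equal:
  assumes "l \<ge> 1"
  shows "generic_pairs l l (\<lambda>P Q.
        W_poly P Q \<noteq> 0 \<and> int (degree (W_poly P Q)) = 2 * int l - 2 \<and>
        F_poly P Q \<noteq> 0 \<and> int (total_degree (F_poly P Q)) = 4 * int l - 2)"
proof (rule generic_pairsI)
  let ?f = "\<lambda>v. (coeff (snd v) l * coeff (fst v) (l - 1) - coeff (fst v) l * coeff (snd v) (l - 1)) *
      (cnj (coeff (fst v) l) * cnj (coeff (fst v) l)) :: complex"
  show "complex_polynomial_in (pair_coords l l) ?f"
    by (intro complex_polynomial_in_mult complex_polynomial_in_cnj complex_polynomial_in_diff
        complex_polynomial_in_coeff) auto
  \<comment> \<open>The witness \<open>Q\<close> has degree \<open>l - 1\<close>, so that only the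
    term \<open>- coeff P l * coeff Q (l - 1) = - \<i>\<close> of the first factor survives.\<close>
  show "(monom 1 l, monom \<i> (l - 1)) \<in> pair_space l l"
    by (simp add: pair_space_def degree_monom_eq)
  show "Im (?f (monom 1 l, monom \<i> (l - 1))) \<noteq> 0"
    using assms by simp
next
  fix P Q :: "complex poly"
  let ?w = "coeff Q l * coeff P (l - 1) - coeff P l * coeff Q (l - 1)"
  assume P: "degree P = l" and Q: "degree Q = l"
    and "Im ((coeff (snd (P, Q)) l * coeff (fst (P, Q)) (l - 1)
          - coeff (fst (P, Q)) l * coeff (snd (P, Q)) (l - 1)) *
        (cnj (coeff (fst (P, Q)) l) * cnj (coeff (fst (P, Q)) l))) \<noteq> 0"
  then have im: "Im (?w * (cnj (coeff P l))\<^sup>2) \<noteq> 0" by (simp add: power2_eq_square)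
  note W = W_poly_equal_degrees[OF P eq_refl[OF Q] assms]
  have "?w \<noteq> 0" using im by (metis mult_zero_left zero_complex.sel(2))
  then have "coeff (W_poly P Q) (2 * l - 2) \<noteq> 0" unfolding W(2) .
  then have deg: "degree (W_poly P Q) = 2 * l - 2" and W0: "W_poly P Q \<noteq> 0"
    using W(1) by (auto intro: le_antisym le_degree)
  have "Im (lead_coeff (W_poly P Q) * (cnj (lead_coeff P))\<^sup>2) \<noteq> 0"
    using im unfolding deg P W(2) .
  from total_degree_F_poly_eq[OF this] W0 deg assms
  show "W_poly P Q \<noteq> 0 \<and> int (degree (W_poly P Q)) = 2 * int l - 2 \<and>
        F_poly P Q \<noteq> 0 \<and> int (total_degree (F_poly P Q)) = 4 * int l - 2"
    by (simp add: P of_nat_diff)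
qed

section \<open>The inflection curve inside the zero locus of \<open>F\<close>\<close>

lemma deriv_ratfun:
  assumes "poly P z \<noteq> 0"
  shows "deriv (ratfun P Q) z = poly (W_poly P Q) z / (poly P z)\<^sup>2"
proof (rule DERIV_imp_deriv)
  show "(ratfun P Q has_field_derivative poly (W_poly P Q) z / (poly P z)\<^sup>2) (at z)"
    unfolding ratfun_def using assms
    by (auto intro!: derivative_eq_intros simp: W_poly_def power2_eq_square)
qed

text \<open>\<open>Im R'\<close> is \<open>(R' - cnj R') / (2 * \<i>)\<close> with
  \<open>R' = W / P^2\<close>; multiplying by \<open>|P|^4 = P^2 * cnj P ^ 2\<close> clears both
  denominators.\<close>

lemma F_fun_eq_Im:
  assumes "poly P z \<noteq> 0"
  shows "F_fun P Q z = of_real (Im (deriv (ratfun P Q) z) * cmod (poly P z) ^ 4)"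
proof -
  let ?p = "poly P z" and ?w = "poly (W_poly P Q) z"
  have n4: "of_real (cmod ?p ^ 4) = ?p\<^sup>2 * (cnj ?p)\<^sup>2"
  proof -
    have "of_real (cmod ?p ^ 4) = (of_real ((cmod ?p)\<^sup>2) :: complex)\<^sup>2"
      by (simp flip: power_mult)
    then show ?thesis unfolding complex_norm_square power_mult_distrib .
  qed
  have diff_cnj: "(w - cnj w) / (2 * \<i>) = of_real (Im w)" for w
    unfolding complex_diff_cnj by (subst nonzero_divide_eq_eq) simp_all
  have "F_fun P Q z = (?w / ?p\<^sup>2 - cnj (?w / ?p\<^sup>2)) / (2 * \<i>) * (?p\<^sup>2 * (cnj ?p)\<^sup>2)"
    using assms by (simp add: F_fun_def field_simps)
  also have "\<dots> = of_real (Im (?w / ?p\<^sup>2)) * of_real (cmod ?p ^ 4)"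
    unfolding n4 diff_cnj ..
  finally show ?thesis by (simp add: deriv_ratfun[OF assms])
qed

lemma zero_locus_F_poly: "zero_locus (F_poly P Q) = {z. F_fun P Q z = 0}"
proof -
  have "poly2 (F_poly P Q) (Re z) (Im z) = 0 \<longleftrightarrow> F_fun P Q z = 0" for z
    using poly2_F_poly[of P Q "Re z" "Im z"] by (metis complex.collapse of_real_eq_0_iff)
  then show ?thesis by (simp add: zero_locus_def)
qed

lemma inflection_curve_subset: "inflection_curve P Q \<subseteq> zero_locus (F_poly P Q)"
  unfolding inflection_curve_def zero_locus_F_poly
proof (rule closure_minimal)
  show "{z. ratfun P Q z \<noteq> 0 \<and> poly P z \<noteq> 0 \<and> Im (deriv (ratfun P Q) z) = 0}
      \<subseteq> {z. F_fun P Q z = 0}"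
    by (auto simp: F_fun_eq_Im)
  show "closed {z. F_fun P Q z = 0}"
    unfolding F_fun_def by (intro closed_Collect_eq continuous_intros) simp_all
qed

section \<open>\<open>F\<close> is not constant\<close>

lemma total_degree_0_poly2:
  assumes "total_degree G = 0"
  shows "poly2 G x y = poly2 G 0 0"
proof -
  have z: "coeff (coeff G j) i = 0" if "i + j > 0" for i j
    using le_total_degree[of G j i] assms that by force
  have "G = [:[:coeff (coeff G 0) 0:]:]"
    by (intro poly_eqI) (auto simp: coeff_pCons z split: nat.splits)
  then obtain c where "G = [:[:c:]:]" by blast
  then show ?thesis by (simp add: poly2_def)
qed

text \<open>The image of a nonconstant \<open>f\<close> would be open, hence contain points with
  different imaginary parts.\<close>

lemma constant_on_if_Im_constant:
  assumes "f holomorphic_on S" "open S" "connected S" "\<And>z. z \<in> S \<Longrightarrow> Im (f z) = c"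
  shows "f constant_on S"
proof (rule ccontr)
  assume nc: "\<not> f constant_on S"
  then have "S \<noteq> {}" by (auto simp: constant_on_def)
  then obtain z where z: "z \<in> S" by blast
  have "open (f ` S)"
    using open_mapping_thm[OF assms(1-3) assms(2) subset_refl nc] .
  then obtain e where e: "e > 0" "ball (f z) e \<subseteq> f ` S"
    using z unfolding open_contains_ball by blast
  have "f z + of_real (e / 2) * \<i> \<in> ball (f z) e"
    using e(1) by (simp add: dist_norm norm_mult)
  then obtain w where "w \<in> S" "f w = f z + of_real (e / 2) * \<i>" using e(2) by (metis imageE subsetD)
  then have "Im (f w) = Im (f z) + e / 2" by simp
  then show False using assms(4)[OF \<open>w \<in> S\<close>] assms(4)[OF z] e(1) by simp
qed

lemma total_degree_F_poly_pos:
  assumes "P \<noteq> 0" "nonconstant_deriv P Q"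
  shows "total_degree (F_poly P Q) > 0"
proof (rule ccontr)
  assume "\<not> total_degree (F_poly P Q) > 0"
  then have "total_degree (F_poly P Q) = 0" by simp
  from total_degree_0_poly2[OF this] obtain c where "poly2 (F_poly P Q) x y = c" for x y
    by blast
  then have F: "F_fun P Q z = of_real c" for z
    using poly2_F_poly[of P Q "Re z" "Im z"] by simp
  let ?S = "{z. poly P z \<noteq> 0}"
  have Im: "Im (deriv (ratfun P Q) z) * cmod (poly P z) ^ 4 = c" if "z \<in> ?S" for z
    using F_fun_eq_Im[of P z Q] F[of z] that of_real_eq_iff by (metis mem_Collect_eq)
  have "\<exists>a. \<forall>z\<in>?S. Im (deriv (ratfun P Q) z) = a"
  proof (cases "\<exists>z. poly P z = 0")
    \<comment> \<open>At a zero of \<open>P\<close> both terms of \<open>F\<close> vanish, which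
      forces \<open>c = 0\<close>.\<close>
    case True
    then obtain z0 where "poly P z0 = 0" by blast
    then have "c = 0" using F[of z0] by (simp add: F_fun_def)
    then show ?thesis using Im by (intro exI[of _ 0]) auto
  next
    \<comment> \<open>Without zeros \<open>P\<close> is constant by the fundamental theorem of
      algebra, and so is the factor \<open>cmod (poly P z) ^ 4\<close>.\<close>
    case False
    then have "constant (poly P)"
      using Fundamental_Theorem_Algebra.fundamental_theorem_of_algebra[of P] by blast
    then have P_const: "poly P z = poly P 0" for z unfolding constant_def by blast
    have "Im (deriv (ratfun P Q) z) = c / cmod (poly P 0) ^ 4" if "z \<in> ?S" for z
      using Im[OF that] that unfolding mem_Collect_eq P_const[of z] by (simp add: field_simps)
    then show ?thesis by blast
  qed
  then obtain a where a: "\<And>z. z \<in> ?S \<Longrightarrow> Im (deriv (ratfun P Q) z) = a" by blast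
  have fin: "finite {z. poly P z = 0}" using assms(1) by (rule poly_roots_finite)
  have S: "?S = - {z. poly P z = 0}" by auto
  have "open ?S" unfolding S using finite_imp_closed[OF fin] by (rule open_Compl)
  moreover have "connected ?S"
    using connected_open_delete_finite[OF open_UNIV connected_UNIV _ fin] by (simp add: S Compl_eq_Diff_UNIV)
  moreover have "ratfun P Q holomorphic_on ?S"
    unfolding ratfun_def by (intro holomorphic_intros) auto
  ultimately have "deriv (ratfun P Q) constant_on ?S"
    using a by (intro constant_on_if_Im_constant[where c = a] holomorphic_deriv)
  then show False using assms(2) by (simp add: nonconstant_deriv_def)
qed

section \<open>Cancellation for equal degrees, and the combined result\<close>

text \<open>With \<open>l\<close> the common degree, both products have degree
  \<open>2 * l - 1\<close>, whereas \<open>W\<close> has degree at most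
  \<open>2 * l - 2\<close>.\<close>

lemma W_poly_leading_terms_cancel:
  assumes "degree Q = degree P" "degree P \<ge> 1"
  shows "degree (pderiv Q * P) = degree (Q * pderiv P)"
    and "lead_coeff (pderiv Q * P) = lead_coeff (Q * pderiv P)"
    and "degree (W_poly P Q) < degree (pderiv Q * P)"
proof -
  have "P \<noteq> 0" "Q \<noteq> 0" "pderiv P \<noteq> 0" "pderiv Q \<noteq> 0"
    using assms by (auto simp: pderiv_eq_0_iff)
  then show deg: "degree (pderiv Q * P) = degree (Q * pderiv P)"
    and "degree (W_poly P Q) < degree (pderiv Q * P)"
    using W_poly_equal_degrees(1)[OF refl eq_refl[OF assms(1)] assms(2)] assms
    by (simp_all add: degree_mult_eq degree_pderiv)
  show "lead_coeff (pderiv Q * P) = lead_coeff (Q * pderiv P)"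
    using assms unfolding lead_coeff_mult by (simp add: degree_pderiv coeff_pderiv)
qed

text \<open>Two constants would give \<open>W = 0\<close> and thus the zero derivative.\<close>

lemma degree_pos_if_nonconstant_deriv:
  assumes "nonconstant_deriv P Q" "degree Q = degree P"
  shows "degree P \<ge> 1"
proof (rule ccontr)
  assume "\<not> degree P \<ge> 1"
  then have "degree P = 0" by simp
  then have "pderiv P = 0" "pderiv Q = 0" using assms(2) by (simp_all add: pderiv_eq_0_iff)
  then have "W_poly P Q = 0" by (simp add: W_poly_def)
  then have "deriv (ratfun P Q) constant_on {z. poly P z \<noteq> 0}"
    unfolding constant_on_def by (auto simp: deriv_ratfun)
  then show False using assms(1) by (simp add: nonconstant_deriv_def)
qed

text \<open>The curve is the zero locus of \<open>F\<close> itself. In the generic clauses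
  \<open>int\<close> avoids truncated subtraction, and nonvanishing is stated because a zero
  polynomial would also have degree 0.\<close>

theorem corollary3p2:
  "(\<forall>P Q. P \<noteq> 0 \<and> coprime P Q \<and> nonconstant_deriv P Q \<longrightarrow>
      (\<exists>C d. real_algebraic_curve C d \<and> d \<le> degree (W_poly P Q) + 2 * degree P \<and>
             inflection_curve P Q \<subseteq> C) \<and>
      (degree Q = degree P \<longrightarrow>
         degree (pderiv Q * P) = degree (Q * pderiv P) \<and>
         lead_coeff (pderiv Q * P) = lead_coeff (Q * pderiv P) \<and>
         degree (W_poly P Q) < degree (pderiv Q * P))) \<and>
   (\<forall>k l. k \<noteq> l \<longrightarrow>
      generic_pairs l k (\<lambda>P Q.
        W_poly P Q \<noteq> 0 \<and> int (degree (W_poly P Q)) = int k + int l - 1 \<and>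
        F_poly P Q \<noteq> 0 \<and> int (total_degree (F_poly P Q)) = int k + 3 * int l - 1)) \<and>
   (\<forall>l. l \<ge> 1 \<longrightarrow>
      generic_pairs l l (\<lambda>P Q.
        W_poly P Q \<noteq> 0 \<and> int (degree (W_poly P Q)) = 2 * int l - 2 \<and>
        F_poly P Q \<noteq> 0 \<and> int (total_degree (F_poly P Q)) = 4 * int l - 2))"
proof (intro conjI allI impI, goal_cases)
  case (1 P Q)
  then have "real_algebraic_curve (zero_locus (F_poly P Q)) (total_degree (F_poly P Q))"
    using total_degree_F_poly_pos unfolding real_algebraic_curve_def by blast
  then show ?case using total_degree_F_poly_le inflection_curve_subset by blast
next
  case (2 P Q)
  then have "degree P \<ge> 1" using degree_pos_if_nonconstant_deriv by blast
  then show ?case using 2 W_poly_leading_terms_cancel(1) by blast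
next
  case (3 P Q)
  then have "degree P \<ge> 1" using degree_pos_if_nonconstant_deriv by blast
  then show ?case using 3 W_poly_leading_terms_cancel(2) by blast
next
  case (4 P Q)
  then have "degree P \<ge> 1" using degree_pos_if_nonconstant_deriv by blast
  then show ?case using 4 W_poly_leading_terms_cancel(3) by blast
next
  case (5 k l)
  then show ?case by (rule generic_degrees_distinct)
next
  case (6 l)
  then show ?case by (rule generic_degrees_equal)
qed

end
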